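(* Suppose that $\{Z_t\}_{t\in\mathbb Z}$ is a sequence of i.i.d. random variables with zero mean and variance equal to one. Let $g(Z_t)=\theta Z_t+\gamma\big[|Z_t|-\mathbb E(|Z_t|)\big]$ with $\theta,\gamma\in\mathbb R$, let $\omega$ be a real constant, and let $\lambda_{d,k}$, $k\in\mathbb N$, be the coefficients of $\lambda(z)=\frac{\alpha(z)}{\beta(z)}(1-z^s)^{-d}=\sum_{k=0}^\infty\lambda_{d,k}z^k$, $|z|<1$. Define $$\ln(\sigma_t^2)-\omega=\sum_{k=0}^\infty\lambda_{d,k}\,g(Z_{t-1-k}),\qquad t\in\mathbb Z.$$ Then this series is well defined and converges almost surely if and only if $d<0.5$. Moreover, the series converges absolutely almost surely for $d\le0$.
   Context: $\mathbb N=\{0,1,2,\dots\}$. Here $d\in\mathbb R$, $s\ge 1$ is an integer, and $\alpha(z)=\sum_{i=0}^p(-\alpha_i)z^i$ and $\beta(z)=\sum_{j=0}^q(-\beta_j)z^j$ are real polynomials of orders $p,q\ge 0$ with $\alpha_0=\beta_0=-1$, with no common roots, and with $\beta(z)\ne0$ for all $|z|\le1$.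
   Formalization: The "only if" part is proved under two added assumptions, without which it fails: g(Z_t) is not almost surely zero, and α(z) is nonzero at some s-th root of unity (1−z^s does not divide α(z)). The "if" part and absolute convergence for d≤0 need neither. *)

theory Defs
  imports "HOL-Probability.Probability" "HOL-Computational_Algebra.Polynomial"
begin

text \<open>The sign convention for lag polynomials is \<open>a(z) = (-a 0) + (-a 1) z + ... + (-a n) z^n\<close>,
  so that \<open>a 0 = -1\<close> normalises the constant term to 1.  The coefficients are real, but the
  polynomial is taken over the complex numbers because its roots and values in the complex
  unit disk matter.\<close>

definition lag_poly :: "(nat \<Rightarrow> real) \<Rightarrow> nat \<Rightarrow> complex poly" where
  "lag_poly a n = (\<Sum>i\<le>n. monom (complex_of_real (- a i)) i)"

text \<open>\<open>c\<close> is the sequence of Taylor coefficients at 0 of \<open>\<alpha>(z)/\<beta>(z) (1 - z^s)^(-d)\<close>, required as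
  an expansion on the whole open unit disk.  There \<open>Re (1 - z^s) > 0\<close>, so the principal branch
  used by \<open>powr\<close> is the analytic branch with value 1 at 0.\<close>

definition lambda_coeffs ::
    "complex poly \<Rightarrow> complex poly \<Rightarrow> nat \<Rightarrow> real \<Rightarrow> (nat \<Rightarrow> real) \<Rightarrow> bool" where
  "lambda_coeffs A B s d c \<longleftrightarrow>
     (\<forall>z::complex. norm z < 1 \<longrightarrow>
        (\<lambda>k. complex_of_real (c k) * z ^ k) sums
          (poly A z / poly B z * (1 - z ^ s) powr complex_of_real (- d)))"

definition egarch_g :: "'a measure \<Rightarrow> real \<Rightarrow> real \<Rightarrow> ('a \<Rightarrow> real) \<Rightarrow> 'a \<Rightarrow> real" where
  "egarch_g M \<theta> \<gamma> X x = \<theta> * X x + \<gamma> * (\<bar>X x\<bar> - (\<integral>y. \<bar>X y\<bar> \<partial>M))"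

definition egarch_term ::
    "'a measure \<Rightarrow> real \<Rightarrow> real \<Rightarrow> (nat \<Rightarrow> real) \<Rightarrow> (int \<Rightarrow> 'a \<Rightarrow> real) \<Rightarrow> int \<Rightarrow> 'a \<Rightarrow> nat \<Rightarrow> real" where
  "egarch_term M \<theta> \<gamma> c Z t x k = c k * egarch_g M \<theta> \<gamma> (Z (t - 1 - int k)) x"

text \<open>The positive solution \<open>\<sigma>\<close> of \<open>ln (\<sigma>^2) - \<omega> = (\<Sum>k. ...)\<close>.  At points where the series
  diverges \<open>suminf\<close> is a meaningless default, so this is only a definition of the volatility
  together with the convergence statement below.\<close>

definition egarch_sigma ::
    "'a measure \<Rightarrow> real \<Rightarrow> real \<Rightarrow> real \<Rightarrow> (nat \<Rightarrow> real) \<Rightarrow> (int \<Rightarrow> 'a \<Rightarrow> real) \<Rightarrow> int \<Rightarrow> 'a \<Rightarrow> real" where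
  "egarch_sigma M \<theta> \<gamma> \<omega> c Z t x = exp ((\<omega> + (\<Sum>k. egarch_term M \<theta> \<gamma> c Z t x k)) / 2)"

text \<open>The defining series converges almost surely, and its sum is \<open>ln (\<sigma>_t^2) - \<omega>\<close> for a random
  variable \<open>\<sigma>_t\<close>.  Since \<open>ln (\<sigma>_t^2) - \<omega>\<close> is literally the \<open>suminf\<close> of the series, the second
  conjunct says exactly that the series is almost surely summable.\<close>

definition log_volatility_well_defined ::
    "'a measure \<Rightarrow> real \<Rightarrow> real \<Rightarrow> real \<Rightarrow> (nat \<Rightarrow> real) \<Rightarrow> (int \<Rightarrow> 'a \<Rightarrow> real) \<Rightarrow> int \<Rightarrow> bool" where
  "log_volatility_well_defined M \<theta> \<gamma> \<omega> c Z t \<longleftrightarrow>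
     egarch_sigma M \<theta> \<gamma> \<omega> c Z t \<in> borel_measurable M \<and>
     (AE x in M. egarch_term M \<theta> \<gamma> c Z t x sums (ln ((egarch_sigma M \<theta> \<gamma> \<omega> c Z t x)\<^sup>2) - \<omega>))"

lemma log_volatility_sums_iff_summable:
  "egarch_term M \<theta> \<gamma> c Z t x sums (ln ((egarch_sigma M \<theta> \<gamma> \<omega> c Z t x)\<^sup>2) - \<omega>)
     \<longleftrightarrow> summable (egarch_term M \<theta> \<gamma> c Z t x)"
proof -
  have "ln ((egarch_sigma M \<theta> \<gamma> \<omega> c Z t x)\<^sup>2) - \<omega> = suminf (egarch_term M \<theta> \<gamma> c Z t x)"
    by (simp add: egarch_sigma_def power2_eq_square flip: exp_add)
  then show ?thesis
    by (simp add: summable_sums_iff)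
qed

end

theory Submission
  imports Defs "HOL-Complex_Analysis.Cauchy_Integral_Formula"
begin

text \<open>
For fixed \<open>t\<close> the innovations \<open>G k = g (Z (t - 1 - k))\<close> are independent, identically distributed,
centred and square integrable.  The theorem follows from two facts: almost sure convergence of
\<open>\<Sum>k. lam k * G k\<close> amounts to \<open>lam \<in> l\<^sup>2\<close>, unless \<open>G\<close> vanishes almost surely, and whether \<open>lam\<close>
lies in \<open>l\<^sup>1\<close> or \<open>l\<^sup>2\<close> is a matter of the strength \<open>d\<close> of the singularities of its generating
function on the unit circle.

Analysis.  The factor \<open>\<alpha> / \<beta>\<close> is holomorphic on a disc of radius greater than 1, so its
coefficients are absolutely summable.  The coefficients of \<open>(1 - z ^ s) powr (- d)\<close> live on the multiples
of \<open>s\<close> and are of order at most \<open>n powr (d - 1)\<close>, hence square summable for \<open>d < 1/2\<close> and absolutely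
summable for \<open>d \<le> 0\<close>.  Convolution with an absolutely summable sequence preserves both properties
(\<open>lambda_coeffs_square_summable\<close>, \<open>lambda_coeffs_abs_summable\<close>).  Conversely, let \<open>d \<ge> 1/2\<close> and let \<open>\<zeta>\<close> be
an \<open>s\<close>-th root of unity with \<open>\<alpha>(\<zeta>) \<noteq> 0\<close>.  On the radius towards \<open>\<zeta>\<close> the generating function is at
least of order \<open>(1 - r) powr (-1/2)\<close>, whereas square-summable coefficients force it to be of smaller
order (\<open>lambda_coeffs_not_square_summable\<close>).  Such a \<open>\<zeta>\<close> must be assumed: a factor \<open>1 - z ^ s\<close> of \<open>\<alpha>\<close>
would in effect lower \<open>d\<close> by 1.

Probability.  If \<open>lam \<in> l\<^sup>2\<close>, the variances of the terms are summable, and Kolmogorov's maximal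
inequality yields almost sure convergence (\<open>AE_summable\<close>).  If the series converges almost surely
and \<open>G\<close> does not vanish almost surely, the characteristic functions of its partial sums, which are
products, converge to a function that is continuous at 0; comparing the factors with
\<open>exp (- c * (lam k)\<^sup>2)\<close> gives \<open>lam \<in> l\<^sup>2\<close> (\<open>square_summable_if_AE_summable\<close>).  For \<open>lam \<in> l\<^sup>1\<close> the sum of the
absolute values has finite expectation (\<open>AE_abs_summable\<close>).
\<close>

section \<open>Summability of the coefficients\<close>

lemma power_series_unique_on_disc:
  fixes a b :: "nat \<Rightarrow> complex"
  assumes a: "\<And>z. norm z < 1 \<Longrightarrow> (\<lambda>k. a k * z ^ k) sums f z"
    and b: "\<And>z. norm z < 1 \<Longrightarrow> (\<lambda>k. b k * z ^ k) sums f z"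
  shows "a = b"
proof -
  have rad: "fps_conv_radius (Abs_fps c) > 0"
    if "\<And>z. norm z < 1 \<Longrightarrow> (\<lambda>k. c k * z ^ k) sums f z" for c :: "nat \<Rightarrow> complex"
  proof -
    have "summable (\<lambda>k. c k * (1/2) ^ k)"
      using that[of "1/2"] by (auto simp: sums_iff)
    from conv_radius_geI[OF this] show ?thesis
      by (simp add: fps_conv_radius_def) (metis ereal_less(2) half_gt_zero less_le_trans zero_less_one)
  qed
  have "eval_fps (Abs_fps a) z = eval_fps (Abs_fps b) z" if "norm z < 1" for z
    using a[OF that] b[OF that] by (simp add: eval_fps_def sums_iff)
  then have "eventually (\<lambda>z. eval_fps (Abs_fps a) z = eval_fps (Abs_fps b) z) (nhds 0)"
    using eventually_nhds_in_open[of "ball 0 1" "0::complex"]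
    by (auto elim!: eventually_mono)
  then have "Abs_fps a = Abs_fps b"
    by (intro eval_fps_eqD rad a b)
  then show ?thesis
    by (simp add: fps_eq_iff fun_eq_iff)
qed

text \<open>A polynomial has finitely many roots, so one without roots in the closed unit disc has none in
a larger disc either.  The quotient is therefore holomorphic beyond the unit circle, and its
Taylor series converges absolutely at 1.\<close>

lemma rational_coeffs_abs_summable:
  fixes A B :: "complex poly"
  assumes B: "\<And>z. norm z \<le> 1 \<Longrightarrow> poly B z \<noteq> 0"
  shows "\<exists>e. summable (\<lambda>k. norm (e k)) \<and>
    (\<forall>z. norm z < 1 \<longrightarrow> (\<lambda>k. e k * z ^ k) sums (poly A z / poly B z))"
proof -
  have "B \<noteq> 0" using B[of 0] by auto
  then have fin: "finite {z. poly B z = 0}" by (rule poly_roots_finite)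
  \<comment> \<open>Any radius above 1 and not above the modulus of a root will do; the 2 covers the case without roots.\<close>
  define R where "R = Min (insert 2 (norm ` {z. poly B z = 0}))"
  have "1 < R"
    using fin B unfolding R_def by (subst Min_gr_iff) (auto simp: not_le[symmetric])
  moreover have "poly B z \<noteq> 0" if "norm z < R" for z
    using that fin unfolding R_def by (subst (asm) Min_gr_iff) auto
  ultimately have R: "1 < R" "\<And>z. norm z < R \<Longrightarrow> poly B z \<noteq> 0" by blast+
  define f where "f z = poly A z / poly B z" for z
  define e where "e n = (deriv ^^ n) f 0 / fact n" for n
  have "f holomorphic_on ball 0 R"
    unfolding f_def by (intro holomorphic_intros) (use R in auto)
  from holomorphic_power_series[OF this]
  have e: "(\<lambda>n. e n * z ^ n) sums f z" if "norm z < R" for z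
    using that by (simp add: e_def)
  define r where "r = (1 + R) / 2"
  have r: "1 < r" "r < R" using R by (auto simp: r_def)
  have "summable (\<lambda>n. e n * of_real r ^ n)"
    using e[of "of_real r"] r by (auto simp: sums_iff)
  from powser_insidea[OF this, of 1] have "summable (\<lambda>k. norm (e k))"
    using r by simp
  moreover have "(\<lambda>k. e k * z ^ k) sums (poly A z / poly B z)" if "norm z < 1" for z
    using e[of z] that R by (simp add: f_def)
  ultimately show ?thesis by blast
qed

text \<open>Euler's limit formula for \<open>1 / \<Gamma> (- a)\<close> gives the exact order of the binomial coefficients;
the limit is 0 when \<open>a\<close> is a natural number, so only the upper bound holds for all \<open>a\<close>.\<close>

lemma gbinomial_powr_bound:
  fixes a :: real
  shows "\<exists>C. \<forall>n>0. \<bar>a gchoose n\<bar> \<le> C * real n powr (- a - 1)"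
proof -
  have "Bseq (\<lambda>n. (a gchoose n) / ((-1)^n / exp ((a+1) * of_real (ln (real n)))))"
    using gbinomial_asymptotic[of a] by (metis convergent_def convergent_imp_Bseq)
  then obtain C where C: "\<And>n. norm ((a gchoose n) / ((-1)^n / exp ((a+1) * of_real (ln (real n))))) \<le> C"
    by (auto simp: Bseq_def)
  have "\<bar>a gchoose n\<bar> \<le> C * real n powr (- a - 1)" if "n > 0" for n
  proof -
    have "\<bar>a gchoose n\<bar> = norm ((a gchoose n) / ((-1)^n / exp ((a+1) * of_real (ln (real n))))) * real n powr (- a - 1)"
      using that by (simp add: powr_def abs_mult exp_minus[symmetric] field_simps flip: exp_add)
    also have "\<dots> \<le> C * real n powr (- a - 1)"
      by (intro mult_right_mono C) auto
    finally show ?thesis .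
  qed
  then show ?thesis by blast
qed

lemma gbinomial_square_summable:
  fixes a :: real
  assumes "a > - 1 / 2"
  shows "summable (\<lambda>n. (a gchoose n)\<^sup>2)"
proof -
  obtain C where C: "\<And>n. n > 0 \<Longrightarrow> \<bar>a gchoose n\<bar> \<le> C * real n powr (- a - 1)"
    using gbinomial_powr_bound[of a] by blast
  have "summable (\<lambda>n. C\<^sup>2 * real n powr (2 * (- a - 1)))"
    using assms by (intro summable_mult) (simp add: summable_real_powr_iff)
  moreover have "norm ((a gchoose n)\<^sup>2) \<le> C\<^sup>2 * real n powr (2 * (- a - 1))" if "n \<ge> 1" for n
  proof -
    have "\<bar>a gchoose n\<bar>\<^sup>2 \<le> (C * real n powr (- a - 1))\<^sup>2"
      using that by (intro power_mono C) auto
    also have "\<dots> = C\<^sup>2 * real n powr (2 * (- a - 1))"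
      using that by (simp add: power_mult_distrib power2_eq_square flip: powr_add)
    finally show ?thesis by simp
  qed
  ultimately show ?thesis
    by (rule summable_comparison_test')
qed

lemma gbinomial_abs_summable:
  fixes a :: real
  assumes "a \<ge> 0"
  shows "summable (\<lambda>n. \<bar>a gchoose n\<bar>)"
proof (cases "a = 0")
  case True
  have "summable (\<lambda>n. \<bar>(0::real) gchoose n\<bar>)"
    by (rule summable_finite[of "{0}"]) (auto simp: gbinomial_0_left)
  then show ?thesis using True by simp
next
  case False
  obtain C where C: "\<And>n. n > 0 \<Longrightarrow> \<bar>a gchoose n\<bar> \<le> C * real n powr (- a - 1)"
    using gbinomial_powr_bound[of a] by blast
  have "summable (\<lambda>n. C * real n powr (- a - 1))"
    using assms False by (intro summable_mult) (simp add: summable_real_powr_iff)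
  moreover have "norm \<bar>a gchoose n\<bar> \<le> C * real n powr (- a - 1)" if "n \<ge> 1" for n
    using that C[of n] by simp
  ultimately show ?thesis
    by (rule summable_comparison_test')
qed

text \<open>The \<open>l\<^sup>1 * l\<^sup>2 \<subseteq> l\<^sup>2\<close> case of Young's convolution inequality.  Cauchy--Schwarz with the weights
\<open>norm (a i)\<close> bounds the square of the convolution by a constant times the convolution of
\<open>norm \<circ> a\<close> with the summable squares of \<open>b\<close>.\<close>

lemma norm_Cauchy_product_square_summable:
  fixes a b :: "nat \<Rightarrow> complex"
  assumes a: "summable (\<lambda>k. norm (a k))" and b: "summable (\<lambda>k. (norm (b k))\<^sup>2)"
  shows "summable (\<lambda>k. (norm (\<Sum>i\<le>k. a i * b (k - i)))\<^sup>2)"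
proof -
  define S where "S = (\<Sum>k. norm (a k))"
  have "summable (\<lambda>k. S * (\<Sum>i\<le>k. norm (a i) * (norm (b (k - i)))\<^sup>2))"
    using a b by (intro summable_mult summable_Cauchy_product) auto
  moreover have "norm ((norm (\<Sum>i\<le>k. a i * b (k - i)))\<^sup>2) \<le>
      S * (\<Sum>i\<le>k. norm (a i) * (norm (b (k - i)))\<^sup>2)" for k
  proof -
    have "norm (\<Sum>i\<le>k. a i * b (k - i)) \<le>
        (\<Sum>i\<le>k. sqrt (norm (a i)) * (sqrt (norm (a i)) * norm (b (k - i))))"
      by (rule order_trans[OF norm_sum]) (simp add: norm_mult mult.assoc[symmetric])
    then have "(norm (\<Sum>i\<le>k. a i * b (k - i)))\<^sup>2 \<le>
        (\<Sum>i\<le>k. sqrt (norm (a i)) * (sqrt (norm (a i)) * norm (b (k - i))))\<^sup>2"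
      by (rule power_mono) simp
    also have "\<dots> \<le> (\<Sum>i\<le>k. (sqrt (norm (a i)))\<^sup>2) *
        (\<Sum>i\<le>k. (sqrt (norm (a i)) * norm (b (k - i)))\<^sup>2)"
      by (rule Cauchy_Schwarz_ineq_sum)
    also have "\<dots> = (\<Sum>i\<le>k. norm (a i)) * (\<Sum>i\<le>k. norm (a i) * (norm (b (k - i)))\<^sup>2)"
      by (simp add: power_mult_distrib)
    also have "\<dots> \<le> S * (\<Sum>i\<le>k. norm (a i) * (norm (b (k - i)))\<^sup>2)"
      unfolding S_def by (intro mult_right_mono sum_le_suminf a sum_nonneg) auto
    finally show ?thesis by simp
  qed
  ultimately show ?thesis
    by (rule summable_comparison_test')
qed

lemma norm_Cauchy_product_summable:
  fixes a b :: "nat \<Rightarrow> complex"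
  assumes a: "summable (\<lambda>k. norm (a k))" and b: "summable (\<lambda>k. norm (b k))"
  shows "summable (\<lambda>k. norm (\<Sum>i\<le>k. a i * b (k - i)))"
proof -
  have "summable (\<lambda>k. \<Sum>i\<le>k. norm (a i) * norm (b (k - i)))"
    using a b by (intro summable_Cauchy_product) auto
  then show ?thesis
    by (rule summable_comparison_test'[where N=0])
       (auto intro!: order_trans[OF norm_sum] simp: norm_mult)
qed

text \<open>The Taylor coefficients of \<open>(1 - z ^ s) powr (- d)\<close> at 0.\<close>

definition seasonal_coeffs :: "nat \<Rightarrow> real \<Rightarrow> nat \<Rightarrow> real" where
  "seasonal_coeffs s d k = (if s dvd k then (-1) ^ (k div s) * ((- d) gchoose (k div s)) else 0)"

lemma seasonal_coeffs_mult [simp]: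
  "s \<ge> 1 \<Longrightarrow> seasonal_coeffs s d (s * n) = (-1) ^ n * ((- d) gchoose n)"
  by (simp add: seasonal_coeffs_def)

lemma seasonal_coeffs_outside:
  "k \<notin> range (\<lambda>n. s * n) \<Longrightarrow> seasonal_coeffs s d k = 0"
  by (auto simp: seasonal_coeffs_def)

lemma strict_mono_times_nat: "s \<ge> 1 \<Longrightarrow> strict_mono (\<lambda>n::nat. s * n)"
  by (auto simp: strict_mono_def)

lemma of_real_gbinomial: "complex_of_real (a gchoose n) = of_real a gchoose n"
  by (simp add: gbinomial_prod_rev)

lemma seasonal_coeffs_sums:
  fixes z :: complex
  assumes "s \<ge> 1" "norm z < 1"
  shows "(\<lambda>k. of_real (seasonal_coeffs s d k) * z ^ k) sums (1 - z ^ s) powr of_real (- d)"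
proof -
  have "norm (- (z ^ s)) < 1"
    using assms by (simp add: norm_power power_less_one_iff)
  from gen_binomial_complex[OF this, of "of_real (- d)"]
  have "(\<lambda>n. of_real ((-1) ^ n * ((- d) gchoose n)) * z ^ (s * n)) sums (1 - z ^ s) powr of_real (- d)"
    by (simp add: power_mult power_minus[of "z ^ s"] mult.assoc mult.left_commute of_real_gbinomial)
  then have "(\<lambda>n. of_real (seasonal_coeffs s d (s * n)) * z ^ (s * n)) sums (1 - z ^ s) powr of_real (- d)"
    using assms(1) by simp
  then show ?thesis
    by (subst (asm) sums_mono_reindex[OF strict_mono_times_nat[OF assms(1)]])
       (auto dest: seasonal_coeffs_outside)
qed

lemma seasonal_coeffs_square_summable:
  assumes "s \<ge> 1" "d < 1 / 2"
  shows "summable (\<lambda>k. (seasonal_coeffs s d k)\<^sup>2)"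
proof -
  have "summable (\<lambda>n. (seasonal_coeffs s d (s * n))\<^sup>2)"
    using gbinomial_square_summable[of "- d"] assms by (simp add: power_mult_distrib flip: power_mult)
  then show ?thesis
    by (subst (asm) summable_mono_reindex[OF strict_mono_times_nat[OF assms(1)]])
       (auto dest: seasonal_coeffs_outside)
qed

lemma seasonal_coeffs_abs_summable:
  assumes "s \<ge> 1" "d \<le> 0"
  shows "summable (\<lambda>k. \<bar>seasonal_coeffs s d k\<bar>)"
proof -
  have "summable (\<lambda>n. \<bar>seasonal_coeffs s d (s * n)\<bar>)"
    using gbinomial_abs_summable[of "- d"] assms by (simp add: abs_mult)
  then show ?thesis
    by (subst (asm) summable_mono_reindex[OF strict_mono_times_nat[OF assms(1)]])
       (auto dest: seasonal_coeffs_outside)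
qed

text \<open>By uniqueness of power series, \<open>lam\<close> is the convolution of the absolutely summable coefficients
of the rational factor with those of the seasonal fractional factor.  It thus
inherits the summability of the latter.\<close>

lemma lambda_coeffs_Cauchy_product:
  assumes "s \<ge> 1" and lam: "lambda_coeffs A B s d lam"
    and B: "\<And>z. norm z \<le> 1 \<Longrightarrow> poly B z \<noteq> 0"
  shows "\<exists>e. summable (\<lambda>k. norm (e k)) \<and>
    (\<forall>k. complex_of_real (lam k) = (\<Sum>i\<le>k. e i * of_real (seasonal_coeffs s d (k - i))))"
proof -
  obtain e where e: "summable (\<lambda>k. norm (e k))"
    "\<And>z. norm z < 1 \<Longrightarrow> (\<lambda>k. e k * z ^ k) sums (poly A z / poly B z)"
    using rational_coeffs_abs_summable[OF B, of A] by blast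
  define b where "b k = complex_of_real (seasonal_coeffs s d k)" for k
  have "(\<lambda>k. complex_of_real (lam k)) = (\<lambda>k. \<Sum>i\<le>k. e i * b (k - i))"
  proof (rule power_series_unique_on_disc)
    fix z :: complex assume z: "norm z < 1"
    show "(\<lambda>k. complex_of_real (lam k) * z ^ k) sums
        (poly A z / poly B z * (1 - z ^ s) powr complex_of_real (- d))"
      using lam z by (simp add: lambda_coeffs_def)
    obtain w where w: "norm z < w" "w < 1" using z dense by blast
    have abs: "summable (\<lambda>k. norm (c k * z ^ k))"
      if "\<And>z. norm z < 1 \<Longrightarrow> (\<lambda>k. c k * z ^ k) sums f z" for c f
      by (rule powser_insidea[of c "of_real w"])
         (use that[of "of_real w"] w norm_ge_zero[of z] in \<open>auto simp: sums_iff\<close>)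
    have b: "\<And>z. norm z < 1 \<Longrightarrow> (\<lambda>k. b k * z ^ k) sums (1 - z ^ s) powr of_real (- d)"
      unfolding b_def by (rule seasonal_coeffs_sums[OF assms(1)])
    have "(\<lambda>k. \<Sum>i\<le>k. (e i * z ^ i) * (b (k - i) * z ^ (k - i))) sums
        ((\<Sum>k. e k * z ^ k) * (\<Sum>k. b k * z ^ k))"
      by (intro Cauchy_product_sums abs[OF e(2)] abs[OF b])
    also have "(\<lambda>k. \<Sum>i\<le>k. (e i * z ^ i) * (b (k - i) * z ^ (k - i))) =
        (\<lambda>k. (\<Sum>i\<le>k. e i * b (k - i)) * z ^ k)"
      by (auto simp: sum_distrib_left sum_distrib_right fun_eq_iff mult_ac simp flip: power_add intro!: sum.cong)
    finally show "(\<lambda>k. (\<Sum>i\<le>k. e i * b (k - i)) * z ^ k) sums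
        (poly A z / poly B z * (1 - z ^ s) powr complex_of_real (- d))"
      using e(2)[OF z] b[OF z] by (simp add: sums_iff)
  qed
  then show ?thesis
    using e(1) by (auto simp: b_def fun_eq_iff)
qed

lemma lambda_coeffs_square_summable:
  assumes "s \<ge> 1" and "lambda_coeffs A B s d lam"
    and "\<And>z. norm z \<le> 1 \<Longrightarrow> poly B z \<noteq> 0" and "d < 1 / 2"
  shows "summable (\<lambda>k. (lam k)\<^sup>2)"
proof -
  obtain e where e: "summable (\<lambda>k. norm (e k))"
    "\<And>k. complex_of_real (lam k) = (\<Sum>i\<le>k. e i * of_real (seasonal_coeffs s d (k - i)))"
    using lambda_coeffs_Cauchy_product[OF assms(1-3)] by blast
  have "summable (\<lambda>k. (norm (complex_of_real (lam k)))\<^sup>2)"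
    unfolding e(2) using seasonal_coeffs_square_summable[OF assms(1,4)]
    by (intro norm_Cauchy_product_square_summable e(1)) simp
  then show ?thesis by simp
qed

lemma lambda_coeffs_abs_summable:
  assumes "s \<ge> 1" and "lambda_coeffs A B s d lam"
    and "\<And>z. norm z \<le> 1 \<Longrightarrow> poly B z \<noteq> 0" and "d \<le> 0"
  shows "summable (\<lambda>k. \<bar>lam k\<bar>)"
proof -
  obtain e where e: "summable (\<lambda>k. norm (e k))"
    "\<And>k. complex_of_real (lam k) = (\<Sum>i\<le>k. e i * of_real (seasonal_coeffs s d (k - i)))"
    using lambda_coeffs_Cauchy_product[OF assms(1-3)] by blast
  have "summable (\<lambda>k. norm (complex_of_real (lam k)))"
    unfolding e(2) using seasonal_coeffs_abs_summable[OF assms(1,4)]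
    by (intro norm_Cauchy_product_summable e(1)) simp
  then show ?thesis by simp
qed

section \<open>Divergence of the squares for long memory\<close>

text \<open>Cauchy--Schwarz against \<open>\<Sum>r\<^sup>2\<^sup>k = 1 / (1 - r\<^sup>2)\<close> bounds a power series with square-summable
coefficients by a multiple of \<open>(1 - r\<^sup>2) powr (-1/2)\<close>.  Splitting off finitely many terms, which
stay bounded by \<open>P\<close>, makes the multiple as small as desired.  This little-o gain is what
excludes the boundary case \<open>d = 1/2\<close>.\<close>

lemma square_summable_radial_growth:
  fixes c :: "nat \<Rightarrow> real" and \<zeta> :: complex
  assumes c: "summable (\<lambda>k. (c k)\<^sup>2)" and \<zeta>: "norm \<zeta> = 1" and "\<epsilon> > 0"
    and f: "\<And>z. norm z < 1 \<Longrightarrow> (\<lambda>k. of_real (c k) * z ^ k) sums f z"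
  shows "\<exists>P. \<forall>r. 0 < r \<and> r < 1 \<longrightarrow>
    sqrt (1 - r\<^sup>2) * norm (f (of_real r * \<zeta>)) \<le> P * sqrt (1 - r\<^sup>2) + \<epsilon>"
proof -
  have "\<epsilon>\<^sup>2 > 0" using \<open>\<epsilon> > 0\<close> by simp
  with c obtain N where N: "\<And>m n. m \<ge> N \<Longrightarrow> norm (\<Sum>k=m..<n. (c k)\<^sup>2) < \<epsilon>\<^sup>2"
    unfolding summable_Cauchy by blast
  define P where "P = (\<Sum>k<N. \<bar>c k\<bar>)"
  have "sqrt (1 - r\<^sup>2) * norm (f (of_real r * \<zeta>)) \<le> P * sqrt (1 - r\<^sup>2) + \<epsilon>"
    if r: "0 < r" "r < 1" for r
  proof -
    have r2: "r\<^sup>2 < 1" using r by (simp add: power_less_one_iff abs_square_less_1)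
    have bound: "norm (\<Sum>k<n. of_real (c k) * (of_real r * \<zeta>) ^ k) \<le> P + \<epsilon> * (1 / sqrt (1 - r\<^sup>2))"
      if "n \<ge> N" for n
    proof -
      have "norm (\<Sum>k<n. of_real (c k) * (of_real r * \<zeta>) ^ k) \<le> (\<Sum>k<n. \<bar>c k\<bar> * r ^ k)"
        using r \<zeta> by (intro order_trans[OF norm_sum]) (simp add: norm_mult norm_power)
      also have "\<dots> = (\<Sum>k<N. \<bar>c k\<bar> * r ^ k) + (\<Sum>k=N..<n. \<bar>c k\<bar> * r ^ k)"
        using that by (simp add: lessThan_atLeast0 sum.atLeastLessThan_concat)
      also have "(\<Sum>k<N. \<bar>c k\<bar> * r ^ k) \<le> P"
        unfolding P_def using r by (intro sum_mono) (simp add: mult_left_le power_le_one)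
      also have "(\<Sum>k=N..<n. \<bar>c k\<bar> * r ^ k) \<le> sqrt ((\<Sum>k=N..<n. (c k)\<^sup>2) * (\<Sum>k=N..<n. (r\<^sup>2) ^ k))"
        using Cauchy_Schwarz_ineq_sum[of "\<lambda>k. \<bar>c k\<bar>" "\<lambda>k. r ^ k" "{N..<n}"]
        by (intro real_le_rsqrt) (simp add: power_mult[symmetric] mult.commute)
      also have "\<dots> \<le> sqrt (\<epsilon>\<^sup>2 * (1 / (1 - r\<^sup>2)))"
      proof (intro real_sqrt_le_mono mult_mono)
        show "(\<Sum>k=N..<n. (c k)\<^sup>2) \<le> \<epsilon>\<^sup>2" using N[of N n] by simp
        have "(\<Sum>k=N..<n. (r\<^sup>2) ^ k) \<le> (\<Sum>k. (r\<^sup>2) ^ k)"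
          using r2 by (intro sum_le_suminf summable_geometric) auto
        then show "(\<Sum>k=N..<n. (r\<^sup>2) ^ k) \<le> 1 / (1 - r\<^sup>2)"
          using r2 by (simp add: suminf_geometric)
      qed (auto intro: sum_nonneg)
      also have "\<dots> = \<epsilon> * (1 / sqrt (1 - r\<^sup>2))"
        using \<open>\<epsilon> > 0\<close> by (simp add: real_sqrt_mult real_sqrt_divide)
      finally show ?thesis by simp
    qed
    have "norm (of_real r * \<zeta>) < 1" using r \<zeta> by (simp add: norm_mult)
    from f[OF this] have "(\<lambda>n. norm (\<Sum>k<n. of_real (c k) * (of_real r * \<zeta>) ^ k)) \<longlonglongrightarrow> norm (f (of_real r * \<zeta>))"
      unfolding sums_def by (rule tendsto_norm)
    then have "norm (f (of_real r * \<zeta>)) \<le> P + \<epsilon> * (1 / sqrt (1 - r\<^sup>2))"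
      by (rule LIMSEQ_le_const2) (use bound in blast)
    then have "sqrt (1 - r\<^sup>2) * norm (f (of_real r * \<zeta>)) \<le> sqrt (1 - r\<^sup>2) * (P + \<epsilon> * (1 / sqrt (1 - r\<^sup>2)))"
      using r2 by (intro mult_left_mono) auto
    also have "\<dots> = P * sqrt (1 - r\<^sup>2) + \<epsilon>"
      using r2 by (simp add: field_simps)
    finally show ?thesis .
  qed
  then show ?thesis by blast
qed

text \<open>Bernoulli's inequality gives \<open>1 - r ^ s \<le> s * (1 - r) \<le> s * (1 - r\<^sup>2)\<close>, so near \<open>r = 1\<close> the singularity
of order \<open>d \<ge> 1/2\<close> is at least as strong as \<open>(1 - r\<^sup>2) powr (-1/2)\<close>.\<close>

lemma seasonal_pole_lower_bound:
  fixes r d :: real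
  assumes "s \<ge> 1" "d \<ge> 1 / 2" "0 < r" "r < 1"
  shows "1 / sqrt (real s) \<le> sqrt (1 - r\<^sup>2) * (1 - r ^ s) powr (- d)"
proof -
  have rs: "0 < r ^ s" "r ^ s < 1" using assms by (auto simp: power_less_one_iff)
  have "1 + real s * (r - 1) \<le> (1 + (r - 1)) ^ s"
    using assms by (intro Bernoulli_inequality) simp
  then have "1 - r ^ s \<le> real s * (1 - r)" by (simp add: algebra_simps)
  also have "\<dots> \<le> real s * (1 - r\<^sup>2)"
    using assms by (intro mult_left_mono) (auto simp: power2_eq_square)
  finally have "sqrt (1 - r ^ s) \<le> sqrt (real s) * sqrt (1 - r\<^sup>2)"
    by (simp flip: real_sqrt_mult)
  then have "1 / sqrt (real s) \<le> sqrt (1 - r\<^sup>2) * (1 / sqrt (1 - r ^ s))"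
    using assms rs by (simp add: field_simps)
  also have "1 / sqrt (1 - r ^ s) = (1 - r ^ s) powr (- (1 / 2))"
    using rs by (simp add: powr_minus powr_half_sqrt field_simps)
  also have "sqrt (1 - r\<^sup>2) * (1 - r ^ s) powr (- (1 / 2)) \<le> sqrt (1 - r\<^sup>2) * (1 - r ^ s) powr (- d)"
    using assms rs by (intro mult_left_mono powr_mono') (auto simp: abs_square_le_1)
  finally show ?thesis .
qed

text \<open>Along the radius towards \<open>\<zeta>\<close> the factor \<open>1 - z ^ s\<close> equals \<open>1 - r ^ s\<close>, while \<open>A / B\<close> tends to a
nonzero limit.  Hence the function grows at least like \<open>(1 - r\<^sup>2) powr (-1/2)\<close>, faster than
square-summable coefficients permit.\<close>

lemma lambda_coeffs_not_square_summable:
  assumes "s \<ge> 1" and lam: "lambda_coeffs A B s d lam"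
    and B: "\<And>z. norm z \<le> 1 \<Longrightarrow> poly B z \<noteq> 0" and "d \<ge> 1 / 2"
    and \<zeta>: "\<zeta> ^ s = 1" "poly A \<zeta> \<noteq> 0"
  shows "\<not> summable (\<lambda>k. (lam k)\<^sup>2)"
proof
  assume sq: "summable (\<lambda>k. (lam k)\<^sup>2)"
  have n\<zeta>: "norm \<zeta> = 1"
    using assms(1) \<zeta>(1) power_eq_imp_eq_base[of "norm \<zeta>" s 1] by (simp flip: norm_power)
  define R where "R z = poly A z / poly B z" for z
  \<comment> \<open>Half of the radial limit of the lower bound for \<open>sqrt (1 - r\<^sup>2) * norm (f (r * \<zeta>))\<close>.\<close>
  define \<epsilon> where "\<epsilon> = norm (R \<zeta>) / sqrt (real s) / 2"
  have "R \<zeta> \<noteq> 0" using \<zeta> B[of \<zeta>] n\<zeta> by (simp add: R_def)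
  then have "\<epsilon> > 0" using assms(1) by (simp add: \<epsilon>_def)
  define f where "f z = R z * (1 - z ^ s) powr complex_of_real (- d)" for z
  have "\<And>z. norm z < 1 \<Longrightarrow> (\<lambda>k. of_real (lam k) * z ^ k) sums f z"
    using lam by (simp add: lambda_coeffs_def f_def R_def)
  from square_summable_radial_growth[OF sq n\<zeta> \<open>\<epsilon> > 0\<close> this] obtain P where
    P: "\<And>r. 0 < r \<Longrightarrow> r < 1 \<Longrightarrow> sqrt (1 - r\<^sup>2) * norm (f (of_real r * \<zeta>)) \<le> P * sqrt (1 - r\<^sup>2) + \<epsilon>"
    by blast
  have le: "norm (R (of_real r * \<zeta>)) * (1 / sqrt (real s)) \<le> P * sqrt (1 - r\<^sup>2) + \<epsilon>"
    if r: "0 < r" "r < 1" for r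
  proof -
    have "r ^ s < 1" using r assms(1) by (simp add: power_less_one_iff)
    then have "norm (complex_of_real (1 - r ^ s) powr complex_of_real (- d)) = (1 - r ^ s) powr (- d)"
      by (subst norm_powr_real_powr) auto
    moreover have "1 - (of_real r * \<zeta>) ^ s = complex_of_real (1 - r ^ s)"
      by (simp add: power_mult_distrib \<zeta>(1))
    ultimately have "sqrt (1 - r\<^sup>2) * norm (f (of_real r * \<zeta>)) =
        norm (R (of_real r * \<zeta>)) * (sqrt (1 - r\<^sup>2) * (1 - r ^ s) powr (- d))"
      by (simp add: f_def norm_mult mult_ac)
    moreover have "norm (R (of_real r * \<zeta>)) * (1 / sqrt (real s)) \<le>
        norm (R (of_real r * \<zeta>)) * (sqrt (1 - r\<^sup>2) * (1 - r ^ s) powr (- d))"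
      using assms(1,4) r by (intro mult_left_mono seasonal_pole_lower_bound) auto
    ultimately show ?thesis using P[OF r] by linarith
  qed
  have lim1: "((\<lambda>r. norm (R (of_real r * \<zeta>)) * (1 / sqrt (real s))) \<longlongrightarrow>
      norm (R (of_real 1 * \<zeta>)) * (1 / sqrt (real s))) (at_left 1)"
    unfolding R_def using B[of \<zeta>] n\<zeta> by (intro tendsto_intros) auto
  have lim2: "((\<lambda>r. P * sqrt (1 - r\<^sup>2) + \<epsilon>) \<longlongrightarrow> P * sqrt (1 - 1\<^sup>2) + \<epsilon>) (at_left 1)"
    by (intro tendsto_intros)
  have "norm (R (of_real 1 * \<zeta>)) * (1 / sqrt (real s)) \<le> P * sqrt (1 - 1\<^sup>2) + \<epsilon>"
    using eventually_at_left_real[of 0 "1::real"]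
    by (intro tendsto_le[OF _ lim2 lim1]) (use le in \<open>auto elim!: eventually_mono\<close>)
  then have "2 * \<epsilon> \<le> \<epsilon>" by (simp add: \<epsilon>_def)
  with \<open>\<epsilon> > 0\<close> show False by simp
qed

section \<open>Kolmogorov's one-series theorem\<close>

lemma (in prob_space) indep_vars_inj_reindex:
  assumes "indep_vars (\<lambda>_. N) X I" "inj_on f J" "f ` J \<subseteq> I"
  shows "indep_vars (\<lambda>_. N) (\<lambda>j. X (f j)) J"
proof (cases "J = {}")
  case False
  have "disjoint_family_on (\<lambda>j. {f j}) J"
    using assms(2) by (auto simp: disjoint_family_on_def inj_on_def)
  with assms False have "indep_vars (\<lambda>j. PiM {f j} (\<lambda>_. N)) (\<lambda>j \<omega>. restrict (\<lambda>i. X i \<omega>) {f j}) J"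
    by (intro indep_vars_restrict[of _ _ I]) auto
  from indep_vars_compose2[OF this, of "\<lambda>j w. w (f j)" "\<lambda>_. N"]
  show ?thesis by simp
qed (simp add: indep_vars_def indep_sets_def)

text \<open>The partial sum of \<open>w\<close> stopped as soon as its absolute value reaches \<open>\<epsilon>\<close>: once that has happened,
the value no longer changes, so the current value alone tells whether to go on.  For random \<open>w\<close> this
recursion replaces the first passage time in the maximal inequality.\<close>

primrec stopped_sum :: "real \<Rightarrow> (nat \<Rightarrow> real) \<Rightarrow> nat \<Rightarrow> real" where
  "stopped_sum \<epsilon> w 0 = 0"
| "stopped_sum \<epsilon> w (Suc n) =
     stopped_sum \<epsilon> w n + (if \<bar>stopped_sum \<epsilon> w n\<bar> < \<epsilon> then w n else 0)"

lemma stopped_sum_cong: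
  "(\<And>k. k < n \<Longrightarrow> w k = v k) \<Longrightarrow> stopped_sum \<epsilon> w n = stopped_sum \<epsilon> v n"
  by (induction n) auto

lemma stopped_sum_cases:
  "if \<forall>k\<le>n. \<bar>\<Sum>i<k. w i\<bar> < \<epsilon> then stopped_sum \<epsilon> w n = (\<Sum>i<n. w i)
   else \<bar>stopped_sum \<epsilon> w n\<bar> \<ge> \<epsilon>"
  by (induction n) (auto simp: le_Suc_eq split: if_splits)

lemma measurable_stopped_sum:
  "{..<n} \<subseteq> I \<Longrightarrow> (\<lambda>w. stopped_sum \<epsilon> w n) \<in> borel_measurable (PiM I (\<lambda>_. borel))"
proof (induction n)
  case (Suc n)
  then have [measurable]: "(\<lambda>w. stopped_sum \<epsilon> w n) \<in> borel_measurable (PiM I (\<lambda>_. borel))"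
    "(\<lambda>w. w n) \<in> borel_measurable (PiM I (\<lambda>_. borel))"
    by (auto simp: lessThan_Suc)
  show ?case by simp
qed simp

locale centered_independent = prob_space +
  fixes X :: "nat \<Rightarrow> 'a \<Rightarrow> real"
  assumes indep: "indep_vars (\<lambda>_. borel) X UNIV"
    and square_integrable: "integrable M (\<lambda>x. (X k x)\<^sup>2)"
    and centered: "expectation (X k) = 0"
begin

lemma rv [measurable]: "X k \<in> borel_measurable M"
  using indep by (auto simp: indep_vars_def)

lemma integrable_X: "integrable M (X k)"
  by (rule square_integrable_imp_integrable[OF rv square_integrable])

lemma measurable_stopped_sum_X [measurable]:
  "(\<lambda>x. stopped_sum \<epsilon> (\<lambda>i. X i x) n) \<in> borel_measurable M"
  by (induction n) simp_all

text \<open>Whether the \<open>n\<close>-th increment is added depends on \<open>X 0, \<dots>, X (n - 1)\<close> only, and \<open>Y\<close> is a measurable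
function of these; so \<open>Y\<close> and \<open>X n\<close> are independent.  \<open>Y\<close> is
integrable because it is bounded by \<open>\<bar>\<epsilon>\<bar>\<close>.\<close>

lemma stopped_sum_increment_uncorrelated:
  fixes n :: nat and \<epsilon> :: real
  defines "Y \<equiv> \<lambda>x. stopped_sum \<epsilon> (\<lambda>i. X i x) n * of_bool (\<bar>stopped_sum \<epsilon> (\<lambda>i. X i x) n\<bar> < \<epsilon>)"
  shows "integrable M (\<lambda>x. Y x * X n x)" and "expectation (\<lambda>x. Y x * X n x) = 0"
proof -
  define F where "F w = stopped_sum \<epsilon> w n * of_bool (\<bar>stopped_sum \<epsilon> w n\<bar> < \<epsilon>)" for w
  have [measurable]: "(\<lambda>w. stopped_sum \<epsilon> w n) \<in> borel_measurable (PiM {..<n} (\<lambda>_. borel))"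
    by (rule measurable_stopped_sum) simp
  have "F \<in> borel_measurable (PiM {..<n} (\<lambda>_. borel))"
    unfolding F_def by measurable
  moreover have "(\<lambda>w. w n) \<in> borel_measurable (PiM {n} (\<lambda>_. borel :: real measure))"
    by measurable
  moreover have "indep_var (PiM {..<n} (\<lambda>_. borel)) (\<lambda>\<omega>. restrict (\<lambda>i. X i \<omega>) {..<n})
      (PiM {n} (\<lambda>_. borel)) (\<lambda>\<omega>. restrict (\<lambda>i. X i \<omega>) {n})"
    by (rule indep_var_restrict[OF indep]) auto
  ultimately have "indep_var borel (F \<circ> (\<lambda>\<omega>. restrict (\<lambda>i. X i \<omega>) {..<n}))
      borel ((\<lambda>w. w n) \<circ> (\<lambda>\<omega>. restrict (\<lambda>i. X i \<omega>) {n}))"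
    by (intro indep_var_compose)
  moreover have "F \<circ> (\<lambda>\<omega>. restrict (\<lambda>i. X i \<omega>) {..<n}) = Y"
    unfolding F_def Y_def comp_def
    by (intro ext arg_cong2[where f="\<lambda>a b. a * of_bool (\<bar>b\<bar> < \<epsilon>)"] stopped_sum_cong) auto
  moreover have "(\<lambda>w. w n) \<circ> (\<lambda>\<omega>. restrict (\<lambda>i. X i \<omega>) {n}) = X n"
    by (simp add: comp_def)
  ultimately have ind: "indep_var borel Y borel (X n)" by simp
  have intY: "integrable M Y"
    unfolding Y_def by (rule integrable_const_bound[where B="\<bar>\<epsilon>\<bar>"]) auto
  show "integrable M (\<lambda>x. Y x * X n x)"
    by (rule indep_var_integrable[OF ind intY integrable_X])
  show "expectation (\<lambda>x. Y x * X n x) = 0"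
    using indep_var_lebesgue_integral[OF ind intY integrable_X] centered by simp
qed

text \<open>The increments of the stopped sum are uncorrelated with the past, so its second moment is the
sum of the second moments of the increments, and stopping only decreases those.\<close>

lemma stopped_sum_second_moment:
  "integrable M (\<lambda>x. (stopped_sum \<epsilon> (\<lambda>i. X i x) n)\<^sup>2) \<and>
   expectation (\<lambda>x. (stopped_sum \<epsilon> (\<lambda>i. X i x) n)\<^sup>2) \<le> (\<Sum>k<n. expectation (\<lambda>x. (X k x)\<^sup>2))"
proof (induction n)
  case (Suc n)
  define S where "S x = stopped_sum \<epsilon> (\<lambda>i. X i x) n" for x
  define h :: "'a \<Rightarrow> real" where "h x = of_bool (\<bar>S x\<bar> < \<epsilon>)" for x
  have [measurable]: "S \<in> borel_measurable M" unfolding S_def by measurable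
  have [measurable]: "h \<in> borel_measurable M" unfolding h_def by measurable
  have eq: "(stopped_sum \<epsilon> (\<lambda>i. X i x) (Suc n))\<^sup>2 =
      (S x)\<^sup>2 + (2 * ((S x * h x) * X n x) + h x * (X n x)\<^sup>2)" for x
    by (simp add: S_def h_def power2_eq_square algebra_simps)
  have i1: "integrable M (\<lambda>x. (S x)\<^sup>2)" and e1: "expectation (\<lambda>x. (S x)\<^sup>2) \<le> (\<Sum>k<n. expectation (\<lambda>x. (X k x)\<^sup>2))"
    using Suc by (auto simp: S_def)
  have i2: "integrable M (\<lambda>x. (S x * h x) * X n x)" and e2: "expectation (\<lambda>x. (S x * h x) * X n x) = 0"
    using stopped_sum_increment_uncorrelated[of \<epsilon> n] by (simp_all add: S_def h_def)
  have i3: "integrable M (\<lambda>x. h x * (X n x)\<^sup>2)"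
    by (rule Bochner_Integration.integrable_bound[OF square_integrable[of n]])
       (auto simp: h_def abs_mult)
  have e3: "expectation (\<lambda>x. h x * (X n x)\<^sup>2) \<le> expectation (\<lambda>x. (X n x)\<^sup>2)"
    by (rule integral_mono[OF i3 square_integrable]) (auto simp: h_def)
  have "expectation (\<lambda>x. (S x)\<^sup>2 + (2 * ((S x * h x) * X n x) + h x * (X n x)\<^sup>2)) =
      expectation (\<lambda>x. (S x)\<^sup>2) + expectation (\<lambda>x. h x * (X n x)\<^sup>2)"
    using i1 i2 i3 e2 by simp
  then show ?case
    unfolding eq using i1 i2 i3 e1 e3 by simp
qed simp

text \<open>If some partial sum reaches \<open>\<epsilon>\<close>, the stopped sum has absolute value at least \<open>\<epsilon>\<close> at time \<open>n\<close>, so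
Markov's inequality for a single random variable suffices.\<close>

lemma Kolmogorov_maximal_inequality:
  assumes "\<epsilon> > 0"
  shows "prob {x \<in> space M. \<exists>k\<le>n. \<bar>\<Sum>i<k. X i x\<bar> \<ge> \<epsilon>} \<le> (\<Sum>k<n. expectation (\<lambda>x. (X k x)\<^sup>2)) / \<epsilon>\<^sup>2"
proof -
  define S where "S x = stopped_sum \<epsilon> (\<lambda>i. X i x) n" for x
  have [measurable]: "S \<in> borel_measurable M" unfolding S_def by measurable
  have "\<epsilon>\<^sup>2 \<le> (S x)\<^sup>2" if "\<exists>k\<le>n. \<bar>\<Sum>i<k. X i x\<bar> \<ge> \<epsilon>" for x
    using stopped_sum_cases[of n "\<lambda>i. X i x" \<epsilon>] that assms
    by (auto simp: S_def abs_le_square_iff[symmetric] not_less split: if_splits)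
  then have "prob {x \<in> space M. \<exists>k\<le>n. \<bar>\<Sum>i<k. X i x\<bar> \<ge> \<epsilon>} \<le> prob {x \<in> space M. (S x)\<^sup>2 \<ge> \<epsilon>\<^sup>2}"
    by (intro finite_measure_mono) auto
  also have "\<dots> \<le> expectation (\<lambda>x. (S x)\<^sup>2) / \<epsilon>\<^sup>2"
    using stopped_sum_second_moment[of \<epsilon> n] assms
    by (intro integral_Markov_inequality_measure[where A="{}"]) (auto simp: S_def)
  also have "\<dots> \<le> (\<Sum>k<n. expectation (\<lambda>x. (X k x)\<^sup>2)) / \<epsilon>\<^sup>2"
    using stopped_sum_second_moment[of \<epsilon> n] by (intro divide_right_mono) (auto simp: S_def)
  finally show ?thesis .
qed

lemma prob_ever_exceeds:
  assumes "\<epsilon> > 0" and sum: "summable (\<lambda>k. expectation (\<lambda>x. (X k x)\<^sup>2))"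
  shows "prob {x \<in> space M. \<exists>k. \<bar>\<Sum>i<k. X i x\<bar> \<ge> \<epsilon>} \<le> (\<Sum>k. expectation (\<lambda>x. (X k x)\<^sup>2)) / \<epsilon>\<^sup>2"
proof -
  define A where "A n = {x \<in> space M. \<exists>k\<le>n. \<bar>\<Sum>i<k. X i x\<bar> \<ge> \<epsilon>}" for n
  have A: "A n \<in> events" for n unfolding A_def by measurable
  have "incseq A" unfolding A_def incseq_def by (auto intro: order_trans)
  with A have "(\<lambda>n. prob (A n)) \<longlonglongrightarrow> prob (\<Union>n. A n)"
    by (intro finite_Lim_measure_incseq) auto
  moreover have "prob (A n) \<le> (\<Sum>k. expectation (\<lambda>x. (X k x)\<^sup>2)) / \<epsilon>\<^sup>2" for n
  proof -
    have "prob (A n) \<le> (\<Sum>k<n. expectation (\<lambda>x. (X k x)\<^sup>2)) / \<epsilon>\<^sup>2"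
      unfolding A_def by (rule Kolmogorov_maximal_inequality[OF assms(1)])
    also have "\<dots> \<le> (\<Sum>k. expectation (\<lambda>x. (X k x)\<^sup>2)) / \<epsilon>\<^sup>2"
      by (intro divide_right_mono sum_le_suminf sum) auto
    finally show ?thesis .
  qed
  ultimately have "prob (\<Union>n. A n) \<le> (\<Sum>k. expectation (\<lambda>x. (X k x)\<^sup>2)) / \<epsilon>\<^sup>2"
    by (intro LIMSEQ_le_const2) auto
  also have "(\<Union>n. A n) = {x \<in> space M. \<exists>k. \<bar>\<Sum>i<k. X i x\<bar> \<ge> \<epsilon>}"
    by (auto simp: A_def)
  finally show ?thesis .
qed

lemma centered_independent_shift: "centered_independent M (\<lambda>k. X (k + m))"
proof
  show "indep_vars (\<lambda>_. borel) (\<lambda>k. X (k + m)) UNIV"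
    by (rule indep_vars_inj_reindex[OF indep]) auto
qed (rule square_integrable centered)+

text \<open>Kolmogorov's one-series theorem.  The maximal inequality for the tail starting at \<open>m\<close> bounds the
probability that the partial sums still move by \<open>\<epsilon>\<close> after \<open>m\<close>, and this bound tends to 0.\<close>

theorem AE_summable:
  assumes sum: "summable (\<lambda>k. expectation (\<lambda>x. (X k x)\<^sup>2))"
  shows "AE x in M. summable (\<lambda>k. X k x)"
proof -
  define V where "V k = expectation (\<lambda>x. (X k x)\<^sup>2)" for k
  have tail: "AE x in M. \<exists>m. \<forall>k. \<bar>\<Sum>i<k. X (i + m) x\<bar> < \<epsilon>" if "\<epsilon> > 0" for \<epsilon>
  proof -
    define B where "B m = {x \<in> space M. \<exists>k. \<bar>\<Sum>i<k. X (i + m) x\<bar> \<ge> \<epsilon>}" for m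
    have B: "B m \<in> events" for m unfolding B_def by measurable
    have bound: "prob (\<Inter>m. B m) \<le> (\<Sum>k. V (k + m)) / \<epsilon>\<^sup>2" for m
    proof -
      interpret shifted: centered_independent M "\<lambda>k. X (k + m)"
        by (rule centered_independent_shift)
      have "prob (\<Inter>m. B m) \<le> prob (B m)"
        by (rule finite_measure_mono) (auto simp: B)
      also have "\<dots> \<le> (\<Sum>k. V (k + m)) / \<epsilon>\<^sup>2"
        unfolding B_def V_def using sum that
        by (intro shifted.prob_ever_exceeds) (auto simp: summable_iff_shift[of "\<lambda>k. expectation (\<lambda>x. (X k x)\<^sup>2)"])
      finally show ?thesis .
    qed
    have "(\<lambda>m. (\<Sum>k. V (k + m)) / \<epsilon>\<^sup>2) \<longlonglongrightarrow> 0 / \<epsilon>\<^sup>2"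
      using sum that by (intro tendsto_divide suminf_exist_split2) (auto simp: V_def)
    then have "prob (\<Inter>m. B m) \<le> 0"
      by (intro LIMSEQ_le_const) (auto intro: bound)
    then have "prob (\<Inter>m. B m) = 0"
      by (simp add: measure_le_0_iff)
    then have "AE x in M. x \<notin> (\<Inter>m. B m)"
      using B by (subst (asm) prob_eq_0) auto
    then show ?thesis
      using AE_space by eventually_elim (auto simp: B_def not_le)
  qed
  have "AE x in M. \<forall>j. \<exists>m. \<forall>k. \<bar>\<Sum>i<k. X (i + m) x\<bar> < inverse (real (Suc j))"
    unfolding AE_all_countable by (intro allI tail) simp
  then show ?thesis
  proof eventually_elim
    case (elim x)
    show ?case
      unfolding summable_Cauchy
    proof (intro allI impI)
      fix e :: real assume "e > 0"
      then obtain j where j: "inverse (real (Suc j)) < e / 2"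
        using reals_Archimedean[of "e / 2"] by auto
      obtain m where m: "\<And>k. \<bar>\<Sum>i<k. X (i + m) x\<bar> < inverse (real (Suc j))"
        using elim by blast
      have block: "\<bar>\<Sum>i=m..<n. X i x\<bar> < e / 2" if "n \<ge> m" for n
        using m[of "n - m"] j that sum.shift_bounds_nat_ivl[of "\<lambda>i. X i x" 0 m "n - m"]
        by (simp add: lessThan_atLeast0)
      have "norm (\<Sum>i=m'..<n. X i x) < e" if "m' \<ge> m" for m' n
      proof (cases "n \<ge> m'")
        case True
        then have "(\<Sum>i=m..<n. X i x) = (\<Sum>i=m..<m'. X i x) + (\<Sum>i=m'..<n. X i x)"
          using that by (simp add: sum.atLeastLessThan_concat)
        moreover have "\<bar>\<Sum>i=m..<n. X i x\<bar> < e / 2" "\<bar>\<Sum>i=m..<m'. X i x\<bar> < e / 2"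
          using block that True by simp_all
        ultimately show ?thesis unfolding real_norm_def by linarith
      qed (use \<open>e > 0\<close> in simp)
      then show "\<exists>N. \<forall>m\<ge>N. \<forall>n. norm (\<Sum>i=m..<n. X i x) < e" by blast
    qed
  qed
qed

end

section \<open>Necessity of square summability\<close>

text \<open>The second-order expansion of the characteristic function at 0, with its error term made at
most half of the quadratic term.  The expectation \<open>R v\<close> in the error bound tends to 0 by dominated
convergence; as it is monotone in \<open>\<bar>v\<bar>\<close>, it is enough to control it along \<open>1 / (n + 1)\<close>.\<close>

lemma (in prob_space) norm_char_le_exp:
  assumes [measurable]: "X \<in> borel_measurable M"
    and sq: "integrable M (\<lambda>x. (X x)\<^sup>2)" and mean: "expectation X = 0"
    and pos: "expectation (\<lambda>x. (X x)\<^sup>2) > 0"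
  shows "\<exists>\<delta>>0. \<forall>v. \<bar>v\<bar> \<le> \<delta> \<longrightarrow>
    norm (char (distr M borel X) v) \<le> exp (- (v\<^sup>2 * expectation (\<lambda>x. (X x)\<^sup>2) / 4))"
proof -
  define V where "V = expectation (\<lambda>x. (X x)\<^sup>2)"
  define R where "R v = expectation (\<lambda>x. min (6 * (X x)\<^sup>2) (\<bar>v\<bar> * \<bar>X x\<bar> ^ 3))" for v
  define a where "a n = inverse (real (Suc n))" for n
  have V: "V > 0" using pos by (simp add: V_def)
  have intX: "integrable M X" by (rule square_integrable_imp_integrable[OF _ sq]) simp
  have a0: "a \<longlonglongrightarrow> 0" unfolding a_def by (rule LIMSEQ_inverse_real_of_nat)
  have intR: "integrable M (\<lambda>x. min (6 * (X x)\<^sup>2) (\<bar>v\<bar> * \<bar>X x\<bar> ^ 3))" for v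
    by (rule Bochner_Integration.integrable_bound[where f="\<lambda>x. 6 * (X x)\<^sup>2"]) (auto intro!: sq)
  have "(\<lambda>n. R (a n)) \<longlonglongrightarrow> expectation (\<lambda>x. min (6 * (X x)\<^sup>2) (\<bar>0\<bar> * \<bar>X x\<bar> ^ 3))"
    unfolding R_def
  proof (rule integral_dominated_convergence[where w="\<lambda>x. 6 * (X x)\<^sup>2"])
    show "AE x in M. (\<lambda>n. min (6 * (X x)\<^sup>2) (\<bar>a n\<bar> * \<bar>X x\<bar> ^ 3))
        \<longlonglongrightarrow> min (6 * (X x)\<^sup>2) (\<bar>0\<bar> * \<bar>X x\<bar> ^ 3)"
      by (intro AE_I2 tendsto_intros a0)
  qed (auto intro!: sq)
  then have "(\<lambda>n. R (a n)) \<longlonglongrightarrow> 0" by (simp add: min_absorb2)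
  then have "\<forall>\<^sub>F n in sequentially. R (a n) < 3 * V / 2"
    using V by (intro order_tendstoD(2)) auto
  moreover have "(\<lambda>n. (a n)\<^sup>2 * V) \<longlonglongrightarrow> 0\<^sup>2 * V"
    by (intro tendsto_intros a0)
  then have "\<forall>\<^sub>F n in sequentially. (a n)\<^sup>2 * V < 2"
    by (rule order_tendstoD(2)) simp
  ultimately have "\<forall>\<^sub>F n in sequentially. R (a n) < 3 * V / 2 \<and> (a n)\<^sup>2 * V < 2"
    by eventually_elim auto
  then obtain n where n: "R (a n) < 3 * V / 2" "(a n)\<^sup>2 * V < 2"
    by (auto dest: eventually_happens)
  have "norm (char (distr M borel X) v) \<le> exp (- (v\<^sup>2 * V / 4))" if v: "\<bar>v\<bar> \<le> a n" for v
  proof -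
    have "v\<^sup>2 \<le> (a n)\<^sup>2" using v power_mono[OF v, of 2] by simp
    then have "v\<^sup>2 * V \<le> (a n)\<^sup>2 * V" using V by (intro mult_right_mono) auto
    with n have v2: "v\<^sup>2 * V \<le> 2" by simp
    have "R v \<le> R (a n)" unfolding R_def
      using v by (intro integral_mono intR min.mono mult_right_mono) auto
    with n have "R v \<le> 3 * V / 2" by simp
    then have "v\<^sup>2 / 6 * R v \<le> v\<^sup>2 / 6 * (3 * V / 2)" by (rule mult_left_mono) simp
    moreover have "norm (char (distr M borel X) v - (1 - v\<^sup>2 * V / 2)) \<le> v\<^sup>2 / 6 * R v"
      unfolding R_def by (rule char_approx3') (use sq intX mean in \<open>auto simp: V_def\<close>)
    moreover have "norm (char (distr M borel X) v) \<le>
        norm (char (distr M borel X) v - (1 - v\<^sup>2 * V / 2)) + norm (complex_of_real (1 - v\<^sup>2 * V / 2))"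
      using norm_triangle_ineq[of "char (distr M borel X) v - (1 - v\<^sup>2 * V / 2)" "complex_of_real (1 - v\<^sup>2 * V / 2)"]
      by simp
    moreover have "norm (complex_of_real (1 - v\<^sup>2 * V / 2)) = 1 - v\<^sup>2 * V / 2"
      unfolding norm_of_real using v2 by simp
    ultimately have "norm (char (distr M borel X) v) \<le> 1 + - (v\<^sup>2 * V / 4)" by linarith
    also have "\<dots> \<le> exp (- (v\<^sup>2 * V / 4))" by (rule exp_ge_add_one_self)
    finally show ?thesis .
  qed
  moreover have "a n > 0" by (simp add: a_def)
  ultimately show ?thesis unfolding V_def by blast
qed

lemma (in prob_space) char_distr_scale:
  assumes [measurable]: "X \<in> borel_measurable M"
  shows "char (distr M borel (\<lambda>x. c * X x)) u = char (distr M borel X) (u * c)"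
  by (simp add: char_def integral_distr mult.assoc)

text \<open>The expectation of \<open>min 1 \<bar>a * G k\<bar>\<close> depends on \<open>\<bar>a\<bar>\<close> only, increases with it and is positive at
\<open>a = 1\<close>.  Since it tends to 0 along \<open>a = c k\<close>, eventually \<open>\<bar>c k\<bar> < 1\<close>.\<close>

lemma (in prob_space) eventually_small_coeffs:
  fixes G :: "nat \<Rightarrow> 'a \<Rightarrow> real" and c :: "nat \<Rightarrow> real"
  assumes [measurable]: "\<And>k. G k \<in> borel_measurable M"
    and id: "\<And>k. distr M borel (G k) = distr M borel (G 0)"
    and nondeg: "\<not> (AE x in M. G 0 x = 0)"
    and conv: "AE x in M. (\<lambda>k. c k * G k x) \<longlonglongrightarrow> 0"
  shows "\<forall>\<^sub>F k in sequentially. \<bar>c k\<bar> < 1"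
proof -
  define m where "m a = expectation (\<lambda>x. min 1 \<bar>a * G 0 x\<bar>)" for a
  have int: "integrable M (\<lambda>x. min 1 \<bar>a * G k x\<bar>)" for a k
    by (rule integrable_const_bound[where B=1]) auto
  have m: "expectation (\<lambda>x. min 1 \<bar>a * G k x\<bar>) = m a" for a k
  proof -
    have "expectation (\<lambda>x. min 1 \<bar>a * G k x\<bar>) = (\<integral>y. min 1 \<bar>a * y\<bar> \<partial>distr M borel (G k))"
      by (subst integral_distr) auto
    also have "\<dots> = m a" unfolding id[of k] m_def by (subst integral_distr) auto
    finally show ?thesis .
  qed
  have "(\<lambda>k. expectation (\<lambda>x. min 1 \<bar>c k * G k x\<bar>)) \<longlonglongrightarrow> expectation (\<lambda>x. 0)"
  proof (rule integral_dominated_convergence[where w="\<lambda>_. 1"])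
    show "AE x in M. (\<lambda>k. min 1 \<bar>c k * G k x\<bar>) \<longlonglongrightarrow> 0"
      using conv
    proof eventually_elim
      case (elim x)
      from tendsto_min[OF tendsto_const tendsto_rabs[OF elim], of 1] show ?case by simp
    qed
  qed auto
  then have lim: "(\<lambda>k. m (c k)) \<longlonglongrightarrow> 0" unfolding m by simp
  have "m 1 \<noteq> 0"
  proof
    assume "m 1 = 0"
    then have "AE x in M. min 1 \<bar>1 * G 0 x\<bar> = 0"
      unfolding m_def by (subst (asm) integral_nonneg_eq_0_iff_AE[OF int]) auto
    then have "AE x in M. G 0 x = 0" by eventually_elim (auto simp: min_def split: if_splits)
    with nondeg show False ..
  qed
  moreover have "m 1 \<ge> 0" unfolding m_def by (rule integral_nonneg_AE) simp
  ultimately have "\<forall>\<^sub>F k in sequentially. m (c k) < m 1"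
    using lim by (intro order_tendstoD(2)) auto
  moreover have "m 1 \<le> m a" if "\<bar>a\<bar> \<ge> 1" for a
    unfolding m_def using that
    by (intro integral_mono int min.mono) (auto simp: abs_mult mult_le_cancel_right1)
  ultimately show ?thesis
    by (auto elim!: eventually_mono simp: not_le[symmetric])
qed

text \<open>A converse of the one-series theorem for multiples of identically distributed variables.  The
characteristic function of the sum is continuous with value 1 at 0, and it is the limit of the
products of \<open>\<phi> (u * c k)\<close>; so for some small \<open>u > 0\<close> these products stay above \<open>1/2\<close>.  But each late
factor is at most \<open>exp (- (u * c k)\<^sup>2 * V / 4)\<close>, which bounds the partial sums of \<open>(c k)\<^sup>2\<close>.  The bound on
the factors holds near 0 only, whence the need for \<open>c\<close> to be eventually bounded.\<close>

theorem (in prob_space) square_summable_if_AE_summable: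
  fixes G :: "nat \<Rightarrow> 'a \<Rightarrow> real" and c :: "nat \<Rightarrow> real"
  assumes indep: "indep_vars (\<lambda>_. borel) G UNIV"
    and id: "\<And>k. distr M borel (G k) = distr M borel (G 0)"
    and sq: "integrable M (\<lambda>x. (G 0 x)\<^sup>2)" and mean: "expectation (G 0) = 0"
    and nondeg: "\<not> (AE x in M. G 0 x = 0)"
    and conv: "AE x in M. summable (\<lambda>k. c k * G k x)"
  shows "summable (\<lambda>k. (c k)\<^sup>2)"
proof -
  have G [measurable]: "G k \<in> borel_measurable M" for k
    using indep by (auto simp: indep_vars_def)
  define V where "V = expectation (\<lambda>x. (G 0 x)\<^sup>2)"
  have "V \<noteq> 0"
    using nondeg unfolding V_def by (subst integral_nonneg_eq_0_iff_AE[OF sq]) auto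
  moreover have "V \<ge> 0" unfolding V_def by (rule integral_nonneg_AE) simp
  ultimately have V: "V > 0" by simp
  define \<phi> where "\<phi> = char (distr M borel (G 0))"
  obtain v0 where v0: "v0 > 0" "\<And>v. \<bar>v\<bar> \<le> v0 \<Longrightarrow> norm (\<phi> v) \<le> exp (- (v\<^sup>2 * V / 4))"
    using norm_char_le_exp[OF G sq mean] V unfolding V_def \<phi>_def by blast
  have "AE x in M. (\<lambda>k. c k * G k x) \<longlonglongrightarrow> 0"
    using conv by eventually_elim (rule summable_LIMSEQ_zero)
  from eventually_small_coeffs[OF G id nondeg this]
  obtain N where N: "\<And>k. k \<ge> N \<Longrightarrow> \<bar>c k\<bar> < 1"
    by (auto simp: eventually_sequentially)
  define S where "S n x = (\<Sum>k<n. c k * G k x)" for n x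
  define T where "T x = (\<Sum>k. c k * G k x)" for x
  have [measurable]: "S n \<in> borel_measurable M" for n unfolding S_def by measurable
  have [measurable]: "T \<in> borel_measurable M" unfolding T_def by measurable
  interpret T: real_distribution "distr M borel T" by (rule real_distribution_distr) simp
  have "(char (distr M borel T) \<longlongrightarrow> char (distr M borel T) 0) (at 0)"
    using T.isCont_char[of 0] by (simp add: isCont_def)
  then have "((\<lambda>u. norm (char (distr M borel T) u)) \<longlongrightarrow> 1) (at 0)"
    using tendsto_norm T.char_zero by force
  then have "\<forall>\<^sub>F u in at 0. norm (char (distr M borel T) u) > 1 / 2"
    by (rule order_tendstoD(1)) simp
  then obtain \<delta> where \<delta>: "\<delta> > 0"
    "\<And>u. u \<noteq> 0 \<Longrightarrow> \<bar>u\<bar> < \<delta> \<Longrightarrow> norm (char (distr M borel T) u) > 1 / 2"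
    by (auto simp: eventually_at dist_real_def)
  define u where "u = min (\<delta> / 2) v0"
  have u: "u > 0" "u < \<delta>" "u \<le> v0" using \<delta>(1) v0(1) by (auto simp: u_def)
  have "(\<lambda>n. char (distr M borel (S n)) u) \<longlonglongrightarrow> char (distr M borel T) u"
    unfolding char_def
  proof (subst (1 2) integral_distr)
    show "(\<lambda>n. CLINT x|M. iexp (u * S n x)) \<longlonglongrightarrow> (CLINT x|M. iexp (u * T x))"
    proof (rule integral_dominated_convergence[where w="\<lambda>_. 1"])
      show "AE x in M. (\<lambda>n. iexp (u * S n x)) \<longlonglongrightarrow> iexp (u * T x)"
        using conv
      proof eventually_elim
        case (elim x)
        then have "(\<lambda>n. S n x) \<longlonglongrightarrow> T x"
          unfolding S_def T_def using summable_LIMSEQ by blast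
        then show ?case by (intro tendsto_intros)
      qed
    qed auto
  qed auto
  then have "(\<lambda>n. norm (char (distr M borel (S n)) u)) \<longlonglongrightarrow> norm (char (distr M borel T) u)"
    by (rule tendsto_norm)
  then have "\<forall>\<^sub>F n in sequentially. norm (char (distr M borel (S n)) u) > 1 / 2"
    by (rule order_tendstoD(1)) (use \<delta>(2)[of u] u in auto)
  then obtain n0 where n0: "\<And>n. n \<ge> n0 \<Longrightarrow> norm (char (distr M borel (S n)) u) > 1 / 2"
    by (auto simp: eventually_sequentially)
  have \<phi>_le_1: "norm (\<phi> v) \<le> 1" for v
    unfolding \<phi>_def by (rule real_distribution.cmod_char_le_1) (rule real_distribution_distr[OF G])
  have upper: "norm (char (distr M borel (S n)) u) \<le> exp (- (u\<^sup>2 * V / 4 * (\<Sum>k=N..<n. (c k)\<^sup>2)))" for n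
  proof -
    have "indep_vars (\<lambda>_. borel) (\<lambda>k x. c k * G k x) {..<n}"
      by (rule indep_vars_compose2[OF indep_vars_subset[OF indep]]) auto
    from char_distr_sum[OF this, of u]
    have "char (distr M borel (S n)) u = (\<Prod>k<n. char (distr M borel (\<lambda>x. c k * G k x)) u)"
      unfolding S_def by simp
    also have "\<dots> = (\<Prod>k<n. \<phi> (u * c k))"
      unfolding char_distr_scale[OF G] \<phi>_def by (intro prod.cong refl) (subst id, rule refl)
    finally have "char (distr M borel (S n)) u = (\<Prod>k<n. \<phi> (u * c k))" .
    then have "norm (char (distr M borel (S n)) u) = (\<Prod>k<n. norm (\<phi> (u * c k)))"
      by (simp add: prod_norm)
    also have "\<dots> \<le> (\<Prod>k<n. if k < N then 1 else exp (- (u\<^sup>2 * V / 4 * (c k)\<^sup>2)))"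
    proof (intro prod_mono conjI norm_ge_zero)
      fix k
      show "norm (\<phi> (u * c k)) \<le> (if k < N then 1 else exp (- (u\<^sup>2 * V / 4 * (c k)\<^sup>2)))"
      proof (cases "k < N")
        case False
        have "\<bar>u * c k\<bar> = u * \<bar>c k\<bar>" using u by (simp add: abs_mult)
        also have "\<dots> \<le> u * 1" using False u N[of k] by (intro mult_left_mono) auto
        also have "\<dots> \<le> v0" using u by simp
        finally have "\<bar>u * c k\<bar> \<le> v0" .
        from v0(2)[OF this] show ?thesis using False by (simp add: power_mult_distrib mult_ac)
      qed (use \<phi>_le_1 in simp)
    qed
    also have "\<dots> = (\<Prod>k=N..<n. exp (- (u\<^sup>2 * V / 4 * (c k)\<^sup>2)))"
      by (rule prod.mono_neutral_cong_right) auto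
    also have "\<dots> = exp (- (u\<^sup>2 * V / 4 * (\<Sum>k=N..<n. (c k)\<^sup>2)))"
      by (simp add: sum_distrib_left sum_negf flip: exp_sum)
    finally show ?thesis .
  qed
  define C where "C = ln 2 / (u\<^sup>2 * V / 4)"
  have "(\<Sum>k<n. (c (k + N))\<^sup>2) \<le> C" for n
  proof -
    define n' where "n' = max n0 (n + N)"
    have "exp (- ln 2) = (1 / 2 :: real)" by (simp add: exp_minus)
    also have "\<dots> < exp (- (u\<^sup>2 * V / 4 * (\<Sum>k=N..<n'. (c k)\<^sup>2)))"
      using n0[of n'] upper[of n'] by (simp add: n'_def)
    finally have "u\<^sup>2 * V / 4 * (\<Sum>k=N..<n'. (c k)\<^sup>2) \<le> ln 2" by simp
    then have "(\<Sum>k=N..<n'. (c k)\<^sup>2) \<le> C"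
      unfolding C_def using u V by (subst pos_le_divide_eq) (auto simp: mult_ac)
    moreover have "(\<Sum>k<n. (c (k + N))\<^sup>2) = (\<Sum>k=N..<n + N. (c k)\<^sup>2)"
      using sum.shift_bounds_nat_ivl[of "\<lambda>k. (c k)\<^sup>2" 0 N n] by (simp add: lessThan_atLeast0)
    moreover have "\<dots> \<le> (\<Sum>k=N..<n'. (c k)\<^sup>2)"
      by (rule sum_mono2) (auto simp: n'_def)
    ultimately show ?thesis by simp
  qed
  then have "summable (\<lambda>k. (c (k + N))\<^sup>2)"
    by (intro summableI_nonneg_bounded) auto
  then show ?thesis by (simp only: summable_iff_shift[of "\<lambda>k. (c k)\<^sup>2"])
qed

text \<open>By monotone convergence the sum of the absolute values has finite expectation.\<close>

lemma (in prob_space) AE_abs_summable: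
  fixes G :: "nat \<Rightarrow> 'a \<Rightarrow> real" and c :: "nat \<Rightarrow> real"
  assumes int: "\<And>k. integrable M (G k)"
    and bound: "\<And>k. expectation (\<lambda>x. \<bar>G k x\<bar>) \<le> B"
    and c: "summable (\<lambda>k. \<bar>c k\<bar>)"
  shows "AE x in M. summable (\<lambda>k. \<bar>c k * G k x\<bar>)"
proof -
  have [measurable]: "G k \<in> borel_measurable M" for k using int by auto
  have "(\<integral>\<^sup>+x. (\<Sum>k. ennreal \<bar>c k * G k x\<bar>) \<partial>M) = (\<Sum>k. \<integral>\<^sup>+x. ennreal \<bar>c k * G k x\<bar> \<partial>M)"
    by (rule nn_integral_suminf) simp
  also have "\<dots> = (\<Sum>k. ennreal (expectation (\<lambda>x. \<bar>c k * G k x\<bar>)))"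
    using int by (intro suminf_cong nn_integral_eq_integral) auto
  also have "\<dots> \<le> (\<Sum>k. ennreal (\<bar>c k\<bar> * B))"
    by (intro suminf_le ennreal_leI) (auto simp: abs_mult intro!: mult_left_mono bound)
  finally have "(\<integral>\<^sup>+x. (\<Sum>k. ennreal \<bar>c k * G k x\<bar>) \<partial>M) \<le> (\<Sum>k. ennreal (\<bar>c k\<bar> * B))" .
  moreover have "(\<Sum>k. ennreal (\<bar>c k\<bar> * B)) \<noteq> \<infinity>"
    using c order_trans[OF integral_nonneg_AE bound[of 0]] 
    by (intro ennreal_suminf_neq_top[unfolded infinity_ennreal_def[symmetric]] summable_mult2) auto
  ultimately have "(\<integral>\<^sup>+x. (\<Sum>k. ennreal \<bar>c k * G k x\<bar>) \<partial>M) \<noteq> \<infinity>"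
    by (auto simp: top_unique)
  then have "AE x in M. (\<Sum>k. ennreal \<bar>c k * G k x\<bar>) \<noteq> \<infinity>"
    by (intro nn_integral_noteq_infinite) measurable
  then show ?thesis
  proof eventually_elim
    case (elim x)
    from elim[unfolded infinity_ennreal_def] show ?case
      by (rule summable_suminf_not_top[OF abs_ge_zero])
  qed
qed

section \<open>The log-volatility series\<close>

text \<open>The volatility is measurable whether or not the series converges, since \<open>suminf\<close> of measurable
functions is measurable; only the convergence is at stake.\<close>

lemma log_volatility_well_defined_iff:
  assumes "\<And>u. Z u \<in> borel_measurable M"
  shows "log_volatility_well_defined M \<theta> \<gamma> \<omega> c Z t \<longleftrightarrow>
    (AE x in M. summable (egarch_term M \<theta> \<gamma> c Z t x))"
proof -
  note assms [measurable]
  have "egarch_sigma M \<theta> \<gamma> \<omega> c Z t \<in> borel_measurable M"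
    unfolding egarch_sigma_def[abs_def] egarch_term_def egarch_g_def by measurable
  then show ?thesis
    by (simp add: log_volatility_well_defined_def log_volatility_sums_iff_summable)
qed

text \<open>All \<open>Z u\<close> have the same mean absolute value \<open>\<mu>\<close>, so every innovation is the same function
\<open>h z = \<theta> * z + \<gamma> * (\<bar>z\<bar> - \<mu>)\<close> of its \<open>Z u\<close>, and independence and equality in law carry over.\<close>

lemma (in prob_space) iid_egarch_innovations:
  fixes Z :: "int \<Rightarrow> 'a \<Rightarrow> real" and \<theta> \<gamma> :: real and t :: int
  defines "G \<equiv> \<lambda>k. egarch_g M \<theta> \<gamma> (Z (t - 1 - int k))"
  assumes ind: "indep_vars (\<lambda>_. borel) Z UNIV"
    and id: "\<And>t u. distr M borel (Z t) = distr M borel (Z u)"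
    and int: "\<And>t. integrable M (Z t)"
    and mean: "\<And>t. expectation (Z t) = 0"
    and sq: "\<And>t. integrable M (\<lambda>x. (Z t x)\<^sup>2)"
  shows "indep_vars (\<lambda>_. borel) G UNIV"
    and "distr M borel (G k) = distr M borel (egarch_g M \<theta> \<gamma> (Z 0))"
    and "integrable M (G k)" and "expectation (G k) = 0"
    and "integrable M (\<lambda>x. (G k x)\<^sup>2)"
proof -
  have Z [measurable]: "Z u \<in> borel_measurable M" for u using int by auto
  define \<mu> where "\<mu> = (\<integral>y. \<bar>y\<bar> \<partial>distr M borel (Z 0))"
  define h where "h z = \<theta> * z + \<gamma> * (\<bar>z\<bar> - \<mu>)" for z
  have [measurable]: "h \<in> borel_measurable borel" unfolding h_def by measurable
  have \<mu>: "expectation (\<lambda>y. \<bar>Z u y\<bar>) = \<mu>" for u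
    unfolding \<mu>_def id[of 0 u] by (subst integral_distr) auto
  have g: "egarch_g M \<theta> \<gamma> (Z u) = (\<lambda>x. h (Z u x))" for u
    unfolding egarch_g_def[abs_def] h_def \<mu> by (rule refl)
  have "indep_vars (\<lambda>_. borel) (\<lambda>k. Z (t - 1 - int k)) UNIV"
    by (rule indep_vars_inj_reindex[OF ind]) (auto simp: inj_on_def)
  then show "indep_vars (\<lambda>_. borel) G UNIV"
    unfolding G_def g by (rule indep_vars_compose2) auto
  have "distr M borel (\<lambda>x. h (Z u x)) = distr (distr M borel (Z u)) borel h" for u
    by (subst distr_distr) (auto simp: comp_def)
  then show "distr M borel (G k) = distr M borel (egarch_g M \<theta> \<gamma> (Z 0))"
    unfolding G_def g using id[of "t - 1 - int k" 0] by metis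
  show "integrable M (G k)"
    unfolding G_def g h_def using int by auto
  show "expectation (G k) = 0"
    unfolding G_def g h_def using int mean by (simp add: \<mu> prob_space)
  have "integrable M (\<lambda>x. (\<theta>\<^sup>2 + \<gamma>\<^sup>2) * (Z u x)\<^sup>2 + 2 * \<theta> * \<gamma> * (Z u x * \<bar>Z u x\<bar>)
      + (\<gamma>\<^sup>2 * \<mu>\<^sup>2 - 2 * \<theta> * \<gamma> * \<mu> * Z u x - 2 * \<gamma>\<^sup>2 * \<mu> * \<bar>Z u x\<bar>))" for u
  proof (intro Bochner_Integration.integrable_add Bochner_Integration.integrable_diff integrable_mult_right)
    show "integrable M (\<lambda>x. Z u x * \<bar>Z u x\<bar>)"
      by (rule Bochner_Integration.integrable_bound[OF sq[of u]]) (auto simp: power2_eq_square abs_mult)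
  qed (use int sq in auto)
  moreover have "(h z)\<^sup>2 = (\<theta>\<^sup>2 + \<gamma>\<^sup>2) * z\<^sup>2 + 2 * \<theta> * \<gamma> * (z * \<bar>z\<bar>)
      + (\<gamma>\<^sup>2 * \<mu>\<^sup>2 - 2 * \<theta> * \<gamma> * \<mu> * z - 2 * \<gamma>\<^sup>2 * \<mu> * \<bar>z\<bar>)" for z
  proof -
    have "\<bar>z\<bar> * \<bar>z\<bar> = z * z" by simp
    then show ?thesis unfolding h_def by algebra
  qed
  ultimately show "integrable M (\<lambda>x. (G k x)\<^sup>2)"
    unfolding G_def g by simp
qed

theorem lemma1p1:
  fixes M :: "'a measure" and Z :: "int \<Rightarrow> 'a \<Rightarrow> real"
    and d \<theta> \<gamma> \<omega> :: real and s p q :: nat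
    and \<alpha> \<beta> lam :: "nat \<Rightarrow> real"
  assumes "prob_space M"
    and "prob_space.indep_vars M (\<lambda>_. borel) Z UNIV"
    and "\<And>t u. distr M borel (Z t) = distr M borel (Z u)"
    and "\<And>t. integrable M (Z t)"
    and "\<And>t. prob_space.expectation M (Z t) = 0"
    and "\<And>t. integrable M (\<lambda>x. (Z t x)\<^sup>2)"
    and "\<And>t. prob_space.variance M (Z t) = 1"
    and "s \<ge> 1"
    and "\<alpha> 0 = -1" and "\<beta> 0 = -1"
    and "\<alpha> p \<noteq> 0" and "\<beta> q \<noteq> 0"
    and "\<And>z. \<not> (poly (lag_poly \<alpha> p) z = 0 \<and> poly (lag_poly \<beta> q) z = 0)"
    and "\<And>z. norm z \<le> 1 \<Longrightarrow> poly (lag_poly \<beta> q) z \<noteq> 0"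
    and "lambda_coeffs (lag_poly \<alpha> p) (lag_poly \<beta> q) s d lam"
  shows "((\<not> (AE x in M. egarch_g M \<theta> \<gamma> (Z 0) x = 0) \<and>
           (\<exists>\<zeta>. \<zeta> ^ s = 1 \<and> poly (lag_poly \<alpha> p) \<zeta> \<noteq> 0)) \<longrightarrow>
          (\<forall>t. log_volatility_well_defined M \<theta> \<gamma> \<omega> lam Z t \<longleftrightarrow> d < 1 / 2)) \<and>
         (d < 1 / 2 \<longrightarrow> (\<forall>t. log_volatility_well_defined M \<theta> \<gamma> \<omega> lam Z t)) \<and>
         (d \<le> 0 \<longrightarrow> (\<forall>t. AE x in M. summable (\<lambda>k. \<bar>egarch_term M \<theta> \<gamma> lam Z t x k\<bar>)))"
proof -
  interpret prob_space M by fact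
  have Z [measurable]: "Z u \<in> borel_measurable M" for u using assms(4)[of u] by auto
  define G where "G t k = egarch_g M \<theta> \<gamma> (Z (t - 1 - int k))" for t :: int and k :: nat
  note innov = iid_egarch_innovations[OF assms(2-6), where \<theta>=\<theta> and \<gamma>=\<gamma>, folded G_def]
  have egterm: "egarch_term M \<theta> \<gamma> lam Z t x = (\<lambda>k. lam k * G t k x)" for t x
    by (simp add: fun_eq_iff egarch_term_def G_def)
  have wd: "log_volatility_well_defined M \<theta> \<gamma> \<omega> lam Z t \<longleftrightarrow> (AE x in M. summable (\<lambda>k. lam k * G t k x))" for t
    by (simp add: log_volatility_well_defined_iff[OF Z] egterm)
  have G0: "distr M borel (G t k) = distr M borel (G t 0)" for t k
    unfolding innov(2) ..
  have same_integral: "expectation (\<lambda>x. f (G t k x)) = expectation (\<lambda>x. f (G t 0 x))"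
    if [measurable]: "f \<in> borel_measurable borel" for f :: "real \<Rightarrow> real" and t k
  proof -
    have [measurable]: "G t j \<in> borel_measurable M" for j using innov(3)[of t j] by auto
    have "expectation (\<lambda>x. f (G t j x)) = integral\<^sup>L (distr M borel (G t j)) f" for j
      by (subst integral_distr) auto
    then show ?thesis by (metis G0)
  qed
  have conv: "log_volatility_well_defined M \<theta> \<gamma> \<omega> lam Z t" if "d < 1 / 2" for t
  proof -
    have sq: "summable (\<lambda>k. (lam k)\<^sup>2)"
      using assms(8,15,14) that by (rule lambda_coeffs_square_summable)
    interpret terms: centered_independent M "\<lambda>k x. lam k * G t k x"
    proof
      show "indep_vars (\<lambda>_. borel) (\<lambda>k x. lam k * G t k x) UNIV"
        by (rule indep_vars_compose2[OF innov(1)]) auto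
      show "integrable M (\<lambda>x. (lam k * G t k x)\<^sup>2)" for k
        using innov(5) by (simp add: power_mult_distrib)
      show "expectation (\<lambda>x. lam k * G t k x) = 0" for k
        using innov(4) by simp
    qed
    have "expectation (\<lambda>x. (lam k * G t k x)\<^sup>2) = (lam k)\<^sup>2 * expectation (\<lambda>x. (G t 0 x)\<^sup>2)" for k
      using same_integral[of "\<lambda>y. y\<^sup>2" t k] by (simp add: power_mult_distrib)
    then have "summable (\<lambda>k. expectation (\<lambda>x. (lam k * G t k x)\<^sup>2))"
      using sq by (simp add: summable_mult2)
    then show ?thesis unfolding wd by (rule terms.AE_summable)
  qed
  have div: "d < 1 / 2"
    if nd: "\<not> (AE x in M. egarch_g M \<theta> \<gamma> (Z 0) x = 0)"
      and \<zeta>: "\<zeta> ^ s = 1" "poly (lag_poly \<alpha> p) \<zeta> \<noteq> 0"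
      and wdt: "log_volatility_well_defined M \<theta> \<gamma> \<omega> lam Z t" for \<zeta> t
  proof (rule ccontr)
    assume "\<not> d < 1 / 2"
    then have "\<not> summable (\<lambda>k. (lam k)\<^sup>2)"
      using lambda_coeffs_not_square_summable[OF assms(8,15,14) _ \<zeta>] by simp
    moreover have "summable (\<lambda>k. (lam k)\<^sup>2)"
    proof (rule square_summable_if_AE_summable[OF innov(1) G0 innov(5) innov(4)])
      show "AE x in M. summable (\<lambda>k. lam k * G t k x)" using wdt unfolding wd .
      have [measurable]: "G t 0 \<in> borel_measurable M" using innov(3)[of t 0] by auto
      have [measurable]: "egarch_g M \<theta> \<gamma> (Z 0) \<in> borel_measurable M"
        unfolding egarch_g_def[abs_def] by measurable
      have "(AE x in M. G t 0 x = 0) \<longleftrightarrow> (AE y in distr M borel (G t 0). y = 0)"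
        by (subst AE_distr_iff) auto
      also have "\<dots> \<longleftrightarrow> (AE x in M. egarch_g M \<theta> \<gamma> (Z 0) x = 0)"
        unfolding innov(2) by (subst AE_distr_iff) auto
      finally show "\<not> (AE x in M. G t 0 x = 0)" using nd by simp
    qed
    ultimately show False ..
  qed
  have abs: "AE x in M. summable (\<lambda>k. \<bar>egarch_term M \<theta> \<gamma> lam Z t x k\<bar>)" if "d \<le> 0" for t
    unfolding egterm
  proof (rule AE_abs_summable[OF innov(3)])
    show "summable (\<lambda>k. \<bar>lam k\<bar>)"
      using assms(8,15,14) that by (rule lambda_coeffs_abs_summable)
    show "expectation (\<lambda>x. \<bar>G t k x\<bar>) \<le> expectation (\<lambda>x. \<bar>G t 0 x\<bar>)" for k
      by (rule eq_refl[OF same_integral]) simp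
  qed
  show ?thesis using conv div abs by blast
qed

end
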